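(* Let $a>0$ and let $f\in\mathcal F_0^+([-a,a])$, $f\not\equiv 0$, be absolutely continuous with $f'\in L^2(-a,a)$. Let $f_s,f_d$ be the left and right reflections of $f$ about its barycenter $\alpha[f]$, and let $w\in[0,1]$ be the corresponding half-mass weight. Then $$U[f]\ \ge\ \Big(w\,\sqrt{U[f_d]}+(1-w)\,\sqrt{U[f_s]}\Big)^2. \qquad ( * )$$ In particular, $U[f]\ge \min\{U[f_s],U[f_d]\}$ for every such $f$. Moreover, equality holds in $( * )$ if and only if $\sigma_x^2[f_d]\,\sigma_\omega^2[\widehat{f_s}]=\sigma_x^2[f_s]\,\sigma_\omega^2[\widehat{f_d}]$.
   Context: For $a>0$ and $K=[-a,a]$, $\mathcal F_{supp}(K)$ is the set of real functions $f=\sum_{i=1}^n P_i\,\mathbf 1_{[a_i,b_i)}$, for some $n\in\mathbb N$, with real polynomials $P_i$ and $-a=a_1<b_1=a_2<\dots<b_{n-1}=a_n<b_n=a$, such that $\lim_{x\to a_i^-}f(x)=f(a_i)$ for $i=2,\dots,n$, and with $f(a)$ equal to the (finite) limit $\lim_{x\to a^-}f(x)$; thus $f$ is a continuous piecewise polynomial on $K$, extended by $0$ outside $K$. $\mathcal F_0^+(K)$ is the set of $f\in\mathcal F_{supp}(K)$ with $f\ge 0$ on $K$ and $f(-a)=f(a)=0$. For a nonzero compactly supported $f\in L^2(\mathbb R)$, with $\|\cdot\|$ the $L^2$ norm and $\hat f(\omega)=\int_{\mathbb R}e^{-i\omega x}f(x)\,dx$, set $\alpha[f]=\frac1{\|f\|^2}\int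 x|f(x)|^2dx$ (the barycenter), $\sigma_x^2[f]=\frac1{\|f\|^2}\int (x-\alpha[f])^2|f(x)|^2dx$, $\beta[\hat f]=\frac1{2\pi\|f\|^2}\int_{\mathbb R}\omega|\hat f(\omega)|^2d\omega$, $\sigma_\omega^2[\hat f]=\frac1{2\pi\|f\|^2}\int_{\mathbb R}(\omega-\beta[\hat f])^2|\hat f(\omega)|^2d\omega\in[0,+\infty]$ and $U[f]=\sigma_x^2[f]\,\sigma_\omega^2[\hat f]$. With $\alpha=\alpha[f]$ (and $f$ extended by $0$ outside $[-a,a]$), the reflections about the barycenter are $f_s(x)=f(x)$ for $x<\alpha$ and $f_s(x)=f(2\alpha-x)$ for $x\ge\alpha$; $f_d(x)=f(2\alpha-x)$ for $x<\alpha$ and $f_d(x)=f(x)$ for $x\ge\alpha$. The half-mass weight is $w=N_+/(N_++N_-)$, where $N_+=\int_{\alpha}^{\infty}|f(x)|^2dx$ and $N_-=\int_{-\infty}^{\alpha}|f(x)|^2dx$; equivalently $w=\|f_d\|^2/(\|f_d\|^2+\|f_s\|^2)$. *)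

theory Defs
  imports "HOL-Analysis.Analysis" "HOL-Computational_Algebra.Polynomial"
begin

section \<open>Compactly supported continuous piecewise polynomials\<close>

text \<open>The members of \<open>F_supp a\<close> are functions on the whole line: the sum of half-open pieces
  vanishes outside \<open>{-a..<a}\<close>, so the first equation also says that \<open>f\<close> is extended by \<open>0\<close>.
  The point \<open>a\<close> is covered by no piece; its value is the left limit.\<close>

definition F_supp :: "real \<Rightarrow> (real \<Rightarrow> real) set" where
  "F_supp a = {f. \<exists>(n::nat) (P :: nat \<Rightarrow> real poly) (l :: nat \<Rightarrow> real) (r :: nat \<Rightarrow> real).
      1 \<le> n \<and> l 1 = - a \<and> r n = a \<and>
      (\<forall>i\<in>{1..n}. l i < r i) \<and> (\<forall>i\<in>{1..<n}. r i = l (Suc i)) \<and>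
      (\<forall>x. x \<noteq> a \<longrightarrow> f x = (\<Sum>i=1..n. poly (P i) x * indicator {l i..<r i} x)) \<and>
      (\<forall>i\<in>{2..n}. (f \<longlongrightarrow> f (l i)) (at_left (l i))) \<and>
      (f \<longlongrightarrow> f a) (at_left a)}"

definition F_0_plus :: "real \<Rightarrow> (real \<Rightarrow> real) set" where
  "F_0_plus a = {f \<in> F_supp a. (\<forall>x\<in>{-a..a}. 0 \<le> f x) \<and> f (- a) = 0 \<and> f a = 0}"

definition absolutely_continuous_fun_on :: "real set \<Rightarrow> (real \<Rightarrow> real) \<Rightarrow> bool" where
  "absolutely_continuous_fun_on S f \<longleftrightarrow>
     (\<forall>\<epsilon>>0. \<exists>\<delta>>0. \<forall>(n::nat) (u :: nat \<Rightarrow> real) (v :: nat \<Rightarrow> real).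
        (\<forall>i<n. u i \<le> v i \<and> {u i..v i} \<subseteq> S) \<longrightarrow>
        disjoint_family_on (\<lambda>i. {u i<..<v i}) {..<n} \<longrightarrow>
        (\<Sum>i<n. v i - u i) < \<delta> \<longrightarrow>
        (\<Sum>i<n. \<bar>f (v i) - f (u i)\<bar>) < \<epsilon>)"

definition square_integrable_on :: "real set \<Rightarrow> (real \<Rightarrow> real) \<Rightarrow> bool" where
  "square_integrable_on S g \<longleftrightarrow>
     set_borel_measurable lebesgue S g \<and> set_integrable lebesgue S (\<lambda>x. (g x)\<^sup>2)"


section \<open>Variances and the uncertainty functional\<close>

definition L2_norm_sq :: "(real \<Rightarrow> complex) \<Rightarrow> real" where
  "L2_norm_sq f = (LINT x|lborel. (cmod (f x))\<^sup>2)"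

definition fourier :: "(real \<Rightarrow> complex) \<Rightarrow> real \<Rightarrow> complex" where
  "fourier f \<omega> = (LINT x|lborel. exp (- \<i> * complex_of_real \<omega> * complex_of_real x) * f x)"

definition barycenter :: "(real \<Rightarrow> complex) \<Rightarrow> real" where
  "barycenter f = 1 / L2_norm_sq f * (LINT x|lborel. x * (cmod (f x))\<^sup>2)"

definition spatial_variance :: "(real \<Rightarrow> complex) \<Rightarrow> real" where
  "spatial_variance f =
     1 / L2_norm_sq f * (LINT x|lborel. (x - barycenter f)\<^sup>2 * (cmod (f x))\<^sup>2)"

text \<open>If the integrand of \<open>freq_mean\<close> is not integrable, the Bochner integral is \<open>0\<close> by convention.
  For square integrable \<open>f\<close> of compact support this is harmless: the value of \<open>freq_variance\<close> is then \<open>\<infinity>\<close>,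
  whatever centre is used.\<close>

definition freq_mean :: "(real \<Rightarrow> complex) \<Rightarrow> real" where
  "freq_mean f = 1 / (2 * pi * L2_norm_sq f) * (LINT \<omega>|lborel. \<omega> * (cmod (fourier f \<omega>))\<^sup>2)"

definition freq_variance :: "(real \<Rightarrow> complex) \<Rightarrow> ennreal" where
  "freq_variance f = ennreal (1 / (2 * pi * L2_norm_sq f)) *
     (\<integral>\<^sup>+\<omega>. ennreal ((\<omega> - freq_mean f)\<^sup>2 * (cmod (fourier f \<omega>))\<^sup>2) \<partial>lborel)"

definition uncertainty :: "(real \<Rightarrow> complex) \<Rightarrow> ennreal" where
  "uncertainty f = ennreal (spatial_variance f) * freq_variance f"

definition ennreal_sqrt :: "ennreal \<Rightarrow> ennreal" where
  "ennreal_sqrt x = (if x = \<infinity> then \<infinity> else ennreal (sqrt (enn2real x)))"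


section \<open>Reflections about the barycenter\<close>

definition left_reflection :: "(real \<Rightarrow> complex) \<Rightarrow> real \<Rightarrow> complex" where
  "left_reflection f x = (if x < barycenter f then f x else f (2 * barycenter f - x))"

definition right_reflection :: "(real \<Rightarrow> complex) \<Rightarrow> real \<Rightarrow> complex" where
  "right_reflection f x = (if x < barycenter f then f (2 * barycenter f - x) else f x)"

definition mass_right :: "(real \<Rightarrow> complex) \<Rightarrow> real" where
  "mass_right f = (LINT x:{barycenter f..}|lborel. (cmod (f x))\<^sup>2)"

definition mass_left :: "(real \<Rightarrow> complex) \<Rightarrow> real" where
  "mass_left f = (LINT x:{..barycenter f}|lborel. (cmod (f x))\<^sup>2)"

definition half_mass_weight :: "(real \<Rightarrow> complex) \<Rightarrow> real" where
  "half_mass_weight f = mass_right f / (mass_right f + mass_left f)"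

text \<open>So neither \<open>w\<close> nor \<open>1 - w\<close> is truncated when embedded into \<^typ>\<open>ennreal\<close>.\<close>

lemma half_mass_weight_bounds: "half_mass_weight f \<in> {0..1}"
proof -
  have "0 \<le> mass_right f" "0 \<le> mass_left f"
    by (simp_all add: mass_right_def mass_left_def set_lebesgue_integral_def)
  then show ?thesis
    by (auto simp: half_mass_weight_def divide_le_eq)
qed

end

theory Submission
  imports Defs "HOL-Probability.Characteristic_Functions"
begin

text \<open>
  Let \<open>c\<close> be the barycenter of \<open>f\<close>. A member of \<open>F_0_plus a\<close> is a continuous function on the whole
  line with compact support and a derivative that is bounded and continuous off a finite set
  (\<open>F_0_plus_pw_C1\<close>), and both reflections about \<open>c\<close> are of the same kind (\<open>pw_C1_reflect\<close>).
  For such a function the mean frequency is \<open>0\<close> and, by Plancherel's identity for the derivative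
  (\<open>plancherel\<close>, \<open>fourier_derivative\<close>), the frequency variance is the integral of
  \<open>(f')\<^sup>2\<close> divided by that of \<open>f\<^sup>2\<close> (\<open>freq_variance_pw_C1\<close>).

  Write \<open>N1\<close>, \<open>A\<close>, \<open>C\<close> for the integrals of \<open>f\<^sup>2\<close>, \<open>(x - c)\<^sup>2 f\<^sup>2\<close> and \<open>(f')\<^sup>2\<close> over \<open>x \<ge> c\<close>, and
  \<open>N2\<close>, \<open>B\<close>, \<open>D\<close> for those over \<open>x \<le> c\<close>. Both \<open>N1\<close> and \<open>N2\<close> are positive (\<open>half_mass_pos\<close>).
  A reflected function is even about \<open>c\<close>, so \<open>c\<close> is its barycenter, and the doubling of all
  integrals cancels in the quotients (\<open>reflect_variances\<close>): the uncertainties of the right and left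
  reflections are \<open>A C / N1\<^sup>2\<close> and \<open>B D / N2\<^sup>2\<close>, while that of \<open>f\<close> is
  \<open>(A + B) (C + D) / (N1 + N2)\<^sup>2\<close>. As \<open>w = N1 / (N1 + N2)\<close>, the lower bound equals
  \<open>(sqrt (A C) + sqrt (B D))\<^sup>2 / (N1 + N2)\<^sup>2\<close>, and the claim is the Cauchy-Schwarz inequality in the
  plane, with equality exactly if \<open>A D = B C\<close> (\<open>cauchy_schwarz_half_moments\<close>).

  Plancherel's identity is obtained by inserting a Gaussian cut-off in frequency: Fubini's theorem and
  the characteristic function of the normal distribution turn the regularised left-hand side into an
  integral of \<open>g\<close> against a smoothed copy of \<open>g\<close>. Removing the cut-off is monotone convergence on one
  side and dominated convergence on the other.
\<close>


section \<open>Bounded functions of compact support\<close>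

text \<open>Bounded Borel functions of bounded support. The predicate is closed under sums, squares,
  reflections and multiplication by continuous functions, and it implies integrability.\<close>

definition bounded_cpt_supp :: "(real \<Rightarrow> real) \<Rightarrow> bool" where
  "bounded_cpt_supp g \<longleftrightarrow> g \<in> borel_measurable borel \<and> (\<exists>M. \<forall>x. \<bar>g x\<bar> \<le> M)
     \<and> (\<exists>R. \<forall>x. R < \<bar>x\<bar> \<longrightarrow> g x = 0)"

lemma bounded_cpt_suppE:
  assumes "bounded_cpt_supp g"
  obtains M R where "0 < M" "0 < R" "\<And>x. \<bar>g x\<bar> \<le> M" "\<And>x. R < \<bar>x\<bar> \<Longrightarrow> g x = 0"
    "g \<in> borel_measurable borel"
proof -
  obtain M R where *: "\<And>x. \<bar>g x\<bar> \<le> M" "\<And>x. R < \<bar>x\<bar> \<Longrightarrow> g x = 0" "g \<in> borel_measurable borel"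
    using assms unfolding bounded_cpt_supp_def by blast
  show thesis
  proof (rule that[of "max M 1" "max R 1"])
    show "\<bar>g x\<bar> \<le> max M 1" for x
      using *(1)[of x] by simp
  qed (use * in auto)
qed

lemma bounded_cpt_suppI:
  assumes "g \<in> borel_measurable borel" "\<And>x. \<bar>g x\<bar> \<le> M" "\<And>x. R < \<bar>x\<bar> \<Longrightarrow> g x = 0"
  shows "bounded_cpt_supp g"
  using assms unfolding bounded_cpt_supp_def by blast

lemma bounded_cpt_supp_borel: "bounded_cpt_supp g \<Longrightarrow> g \<in> borel_measurable borel"
  by (simp add: bounded_cpt_supp_def)

lemma bounded_cpt_supp_add:
  assumes "bounded_cpt_supp u" "bounded_cpt_supp v"
  shows "bounded_cpt_supp (\<lambda>x. u x + v x)"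
proof -
  obtain M R where u: "\<And>x. \<bar>u x\<bar> \<le> M" "\<And>x. R < \<bar>x\<bar> \<Longrightarrow> u x = 0" "u \<in> borel_measurable borel"
    using bounded_cpt_suppE[OF assms(1)] by metis
  obtain M' R' where v: "\<And>x. \<bar>v x\<bar> \<le> M'" "\<And>x. R' < \<bar>x\<bar> \<Longrightarrow> v x = 0" "v \<in> borel_measurable borel"
    using bounded_cpt_suppE[OF assms(2)] by metis
  have "\<bar>u x + v x\<bar> \<le> M + M'" for x
    using u(1)[of x] v(1)[of x] by linarith
  then show ?thesis
    using u v by (intro bounded_cpt_suppI[where M="M + M'" and R="max R R'"]) auto
qed

lemma bounded_cpt_supp_sum:
  assumes "\<And>i. i \<in> A \<Longrightarrow> bounded_cpt_supp (u i)"
  shows "bounded_cpt_supp (\<lambda>x. \<Sum>i\<in>A. u i x)"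
  using assms
proof (induction A rule: infinite_finite_induct)
  case (insert i A)
  then show ?case by (simp add: bounded_cpt_supp_add)
qed (auto intro!: bounded_cpt_suppI[where M=0 and R=0])

lemma bounded_cpt_supp_mult:
  assumes "bounded_cpt_supp g" "continuous_on UNIV k"
  shows "bounded_cpt_supp (\<lambda>x. k x * g x)"
proof -
  obtain M R where g: "0 < M" "0 < R" "\<And>x. \<bar>g x\<bar> \<le> M" "\<And>x. R < \<bar>x\<bar> \<Longrightarrow> g x = 0"
    "g \<in> borel_measurable borel"
    using bounded_cpt_suppE[OF assms(1)] by metis
  have "bounded (k ` {-R..R})"
    by (intro compact_imp_bounded compact_continuous_image continuous_on_subset[OF assms(2)]) auto
  then obtain K where "\<forall>x\<in>{-R..R}. \<bar>k x\<bar> \<le> K"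
    by (auto simp: bounded_iff)
  then have K: "\<bar>k x\<bar> \<le> K" if "\<bar>x\<bar> \<le> R" for x
    using that by (simp add: abs_le_iff minus_le_iff)
  have "\<bar>k x * g x\<bar> \<le> \<bar>K\<bar> * M" for x
  proof (cases "\<bar>x\<bar> \<le> R")
    case True
    then show ?thesis
      using K[of x] g(1,3) unfolding abs_mult by (intro mult_mono) (auto intro: order_trans)
  next
    case False
    then show ?thesis using g by simp
  qed
  moreover have "k \<in> borel_measurable borel"
    using assms(2) by (rule borel_measurable_continuous_onI)
  ultimately show ?thesis
    using g(4,5) by (intro bounded_cpt_suppI[where M="\<bar>K\<bar> * M" and R=R]) auto
qed

lemma bounded_cpt_supp_square:
  assumes "bounded_cpt_supp g"
  shows "bounded_cpt_supp (\<lambda>x. (g x)\<^sup>2)"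
proof -
  obtain M R where g: "0 < M" "0 < R" "\<And>x. \<bar>g x\<bar> \<le> M" "\<And>x. R < \<bar>x\<bar> \<Longrightarrow> g x = 0"
    and [measurable]: "g \<in> borel_measurable borel"
    using bounded_cpt_suppE[OF assms(1)] by metis
  have "\<bar>(g x)\<^sup>2\<bar> \<le> M\<^sup>2" for x
    using g(3)[of x] by (simp add: abs_le_square_iff[symmetric])
  then show ?thesis
    using g(4) by (intro bounded_cpt_suppI[where M="M\<^sup>2" and R=R]) auto
qed

lemma bounded_cpt_supp_integrable:
  assumes "bounded_cpt_supp g"
  shows "integrable lborel g"
proof -
  obtain M R where g: "0 < M" "0 < R" "\<And>x. \<bar>g x\<bar> \<le> M" "\<And>x. R < \<bar>x\<bar> \<Longrightarrow> g x = 0"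
    and [measurable]: "g \<in> borel_measurable borel"
    using bounded_cpt_suppE[OF assms] by metis
  show ?thesis
  proof (rule integrableI_bounded_set[where A="{-R..R}" and B=M])
    have "g x = 0" if "x \<notin> {-R..R}" for x
      using that by (intro g(4)) auto
    then show "AE x in lborel. x \<notin> {-R..R} \<longrightarrow> g x = 0" by simp
  qed (use g in auto)
qed

text \<open>The domination hypothesis behind the two applications of Fubini's theorem in the Plancherel
  argument: the kernel is bounded and the second factor has bounded support.\<close>

lemma integrable_product_bounded_cpt_supp:
  fixes k :: "real \<Rightarrow> real \<Rightarrow> complex"
  assumes g: "bounded_cpt_supp g" and \<mu>: "prob_space \<mu>" "sets \<mu> = sets borel"
    and k: "case_prod k \<in> borel_measurable (borel \<Otimes>\<^sub>M borel)" "\<And>z x. norm (k z x) \<le> K"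
  shows "integrable (\<mu> \<Otimes>\<^sub>M lborel) (\<lambda>(z, x). k z x * complex_of_real (g x))"
proof -
  obtain M R where g: "0 < M" "0 < R" "\<And>x. \<bar>g x\<bar> \<le> M" "\<And>x. R < \<bar>x\<bar> \<Longrightarrow> g x = 0"
    and [measurable]: "g \<in> borel_measurable borel"
    using bounded_cpt_suppE[OF g] by metis
  interpret prob_space \<mu> by fact
  note \<mu>(2)[measurable_cong] k(1)[measurable]
  show ?thesis
  proof (rule integrableI_bounded_set[where A="space \<mu> \<times> {-R..R}" and B="K * M"])
    show "emeasure (\<mu> \<Otimes>\<^sub>M lborel) (space \<mu> \<times> {-R..R}) < \<infinity>"
      using g(2) by (subst lborel.emeasure_pair_measure_Times) (auto simp: emeasure_space_1)
    have [measurable]: "case_prod k \<in> borel_measurable (\<mu> \<Otimes>\<^sub>M lborel)"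
      by measurable
    show "(\<lambda>(z, x). k z x * complex_of_real (g x)) \<in> borel_measurable (\<mu> \<Otimes>\<^sub>M lborel)"
      by measurable
    have "0 \<le> K" using order_trans[OF norm_ge_zero k(2)] .
    then show "AE p in \<mu> \<Otimes>\<^sub>M lborel. p \<in> space \<mu> \<times> {-R..R} \<longrightarrow>
        norm (case p of (z, x) \<Rightarrow> k z x * complex_of_real (g x)) \<le> K * M"
      using k(2) g(3) by (auto intro!: AE_I2 mult_mono simp: norm_mult)
    have "- R \<le> x \<and> x \<le> R" if "g x \<noteq> 0" for x
      using that g(4)[of x] by linarith
    then show "AE p in \<mu> \<Otimes>\<^sub>M lborel. p \<notin> space \<mu> \<times> {-R..R} \<longrightarrow>
        (case p of (z, x) \<Rightarrow> k z x * complex_of_real (g x)) = 0"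
      by (auto intro!: AE_I2 simp: space_pair_measure)
  qed measurable
qed


section \<open>Plancherel's identity\<close>

lemma fourier_measurable [measurable]:
  assumes [measurable]: "F \<in> borel_measurable borel"
  shows "fourier F \<in> borel_measurable borel"
  unfolding fourier_def by measurable

lemma norm_fourier_le:
  "norm (fourier F \<omega>) \<le> (LINT x|lborel. norm (F x))"
  unfolding fourier_def by (rule order_trans[OF integral_norm_bound]) (simp add: norm_mult)

lemma cnj_fourier_real:
  "cnj (fourier (\<lambda>x. complex_of_real (g x)) \<omega>)
     = (LINT x|lborel. exp (\<i> * complex_of_real (\<omega> * x)) * complex_of_real (g x))"
  unfolding fourier_def
  by (subst Bochner_Integration.integral_cnj[symmetric], intro Bochner_Integration.integral_cong refl)
     (simp add: exp_cnj mult.assoc)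

text \<open>Averaging \<open>\<bar>fourier G (z * t)\<bar>\<^sup>2\<close> over a standard normal \<open>z\<close> replaces the oscillating kernel by its
  mean, which is the characteristic function of the normal distribution.\<close>

lemma gaussian_mean_fourier:
  assumes g: "bounded_cpt_supp g"
  defines "G \<equiv> (\<lambda>x. complex_of_real (g x))"
  shows "(LINT z|std_normal_distribution. (cmod (fourier G (z * t)))\<^sup>2)
    = (LINT y|lborel. g y * (LINT x|lborel. g x * exp (- ((y - x) * t)\<^sup>2 / 2)))"
proof -
  let ?\<mu> = "std_normal_distribution"
  interpret \<mu>: prob_space ?\<mu>
    using real_dist_normal_dist by (simp add: real_distribution_def)
  interpret P: pair_sigma_finite ?\<mu> "lborel :: real measure" ..
  have [measurable]: "g \<in> borel_measurable borel"
    using g by (rule bounded_cpt_supp_borel)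
  have [measurable]: "G \<in> borel_measurable borel"
    unfolding G_def by measurable
  have pr: "prob_space ?\<mu>" by (rule \<mu>.prob_space_axioms)
  have se: "sets ?\<mu> = sets borel" by simp
  define N where "N = (LINT x|lborel. norm (G x))"
  have inner: "(LINT z|?\<mu>. fourier G (z * t) * exp (\<i> * complex_of_real (z * t * y)))
      = complex_of_real (LINT x|lborel. g x * exp (- ((y - x) * t)\<^sup>2 / 2))" for y
  proof -
    let ?k = "\<lambda>z x. exp (\<i> * complex_of_real (z * (t * (y - x))))"
    have "(LINT z|?\<mu>. fourier G (z * t) * exp (\<i> * complex_of_real (z * t * y)))
      = (LINT z|?\<mu>. (LINT x|lborel. ?k z x * complex_of_real (g x)))"
      unfolding fourier_def integral_mult_left_zero[symmetric] G_def
      by (intro Bochner_Integration.integral_cong refl)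
         (simp add: exp_add[symmetric] algebra_simps flip: exp_diff exp_minus)
    also have "\<dots> = (LINT x|lborel. (LINT z|?\<mu>. ?k z x * complex_of_real (g x)))"
      by (rule P.Fubini_integral[symmetric], rule integrable_product_bounded_cpt_supp[OF g pr se, of _ 1])
        (auto simp: norm_exp_i_times)
    also have "\<dots> = (LINT x|lborel. char ?\<mu> (t * (y - x)) * complex_of_real (g x))"
      by (simp add: char_def mult.commute)
    also have "\<dots> = (LINT x|lborel. complex_of_real (g x * exp (- ((y - x) * t)\<^sup>2 / 2)))"
      by (simp add: char_std_normal_distribution mult.commute)
    also have "\<dots> = complex_of_real (LINT x|lborel. g x * exp (- ((y - x) * t)\<^sup>2 / 2))"
      by (rule integral_complex_of_real)
    finally show ?thesis .
  qed
  have "complex_of_real (LINT z|?\<mu>. (cmod (fourier G (z * t)))\<^sup>2)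
      = (LINT z|?\<mu>. fourier G (z * t) * cnj (fourier G (z * t)))"
    by (simp add: complex_norm_square[symmetric] flip: integral_complex_of_real of_real_power)
  also have "\<dots> = (LINT z|?\<mu>. (LINT y|lborel.
      (fourier G (z * t) * exp (\<i> * complex_of_real (z * t * y))) * complex_of_real (g y)))"
    unfolding G_def cnj_fourier_real integral_mult_right_zero[symmetric] by (simp add: mult.assoc)
  also have "\<dots> = (LINT y|lborel. (LINT z|?\<mu>.
      (fourier G (z * t) * exp (\<i> * complex_of_real (z * t * y))) * complex_of_real (g y)))"
  proof (rule P.Fubini_integral[symmetric], rule integrable_product_bounded_cpt_supp[OF g pr se])
    show "norm (fourier G (z * t) * exp (\<i> * complex_of_real (z * t * y))) \<le> N" for z y
      using norm_fourier_le[of G "z * t"] by (simp add: norm_mult N_def norm_exp_i_times)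
  qed measurable
  also have "\<dots> = (LINT y|lborel. complex_of_real
      (g y * (LINT x|lborel. g x * exp (- ((y - x) * t)\<^sup>2 / 2))))"
    by (simp only: integral_mult_left_zero inner) (simp add: mult.commute)
  also have "\<dots> = complex_of_real (LINT y|lborel. g y * (LINT x|lborel. g x * exp (- ((y - x) * t)\<^sup>2 / 2)))"
    by (rule integral_complex_of_real)
  finally show ?thesis
    by (simp only: of_real_eq_iff)
qed

text \<open>Plancherel's identity with a Gaussian cut-off of width \<open>t\<close> in frequency, which amounts to
  smoothing \<open>g\<close> at scale \<open>1 / t\<close> in space.\<close>

lemma plancherel_gaussian:
  assumes g: "bounded_cpt_supp g" and t: "0 < t"
  shows "(\<integral>\<^sup>+\<omega>. ennreal ((cmod (fourier (\<lambda>x. complex_of_real (g x)) \<omega>))\<^sup>2 * exp (- (\<omega> / t)\<^sup>2 / 2)) \<partial>lborel)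
    = ennreal (2 * pi * (LINT y|lborel. g y * (LINT u|std_normal_distribution. g (y + u / t))))"
proof -
  let ?\<mu> = "std_normal_distribution"
  let ?h = "fourier (\<lambda>x. complex_of_real (g x))"
  interpret \<mu>: prob_space ?\<mu>
    using real_dist_normal_dist by (simp add: real_distribution_def)
  have [measurable]: "g \<in> borel_measurable borel"
    using g by (rule bounded_cpt_supp_borel)
  have dens: "std_normal_density x * sqrt (2 * pi) = exp (- x\<^sup>2 / 2)" for x
    by (simp add: std_normal_density_def)
  have "(\<integral>\<^sup>+\<omega>. ennreal ((cmod (?h \<omega>))\<^sup>2 * exp (- (\<omega> / t)\<^sup>2 / 2)) \<partial>lborel)
    = ennreal t * (\<integral>\<^sup>+z. ennreal ((cmod (?h (z * t)))\<^sup>2 * exp (- z\<^sup>2 / 2)) \<partial>lborel)"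
    using t by (subst nn_integral_real_affine[where c=t and t=0]) (auto simp: mult.commute)
  also have "(\<integral>\<^sup>+z. ennreal ((cmod (?h (z * t)))\<^sup>2 * exp (- z\<^sup>2 / 2)) \<partial>lborel)
    = (\<integral>\<^sup>+z. ennreal (sqrt (2 * pi)) * (ennreal (std_normal_density z) * ennreal ((cmod (?h (z * t)))\<^sup>2)) \<partial>lborel)"
  proof (intro nn_integral_cong)
    fix z :: real
    have "(cmod (?h (z * t)))\<^sup>2 * exp (- z\<^sup>2 / 2)
        = sqrt (2 * pi) * (std_normal_density z * (cmod (?h (z * t)))\<^sup>2)"
      by (subst dens[symmetric]) (simp only: mult_ac)
    then show "ennreal ((cmod (?h (z * t)))\<^sup>2 * exp (- z\<^sup>2 / 2))
        = ennreal (sqrt (2 * pi)) * (ennreal (std_normal_density z) * ennreal ((cmod (?h (z * t)))\<^sup>2))"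
      by (simp only:) (simp add: ennreal_mult del: real_sqrt_mult)
  qed
  also have "\<dots> = ennreal (sqrt (2 * pi)) * (\<integral>\<^sup>+z. ennreal ((cmod (?h (z * t)))\<^sup>2) \<partial>?\<mu>)"
    by (subst nn_integral_cmult) (auto simp: nn_integral_density)
  also have "(\<integral>\<^sup>+z. ennreal ((cmod (?h (z * t)))\<^sup>2) \<partial>?\<mu>) = ennreal (LINT z|?\<mu>. (cmod (?h (z * t)))\<^sup>2)"
  proof (rule nn_integral_eq_integral)
    show "integrable ?\<mu> (\<lambda>z. (cmod (?h (z * t)))\<^sup>2)"
      by (rule \<mu>.integrable_const_bound[where B="(LINT x|lborel. norm (complex_of_real (g x)))\<^sup>2"])
         (auto intro!: power_mono norm_fourier_le simp del: norm_of_real)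
  qed auto
  also have "(LINT z|?\<mu>. (cmod (?h (z * t)))\<^sup>2)
    = (LINT y|lborel. g y * (LINT x|lborel. g x * exp (- ((y - x) * t)\<^sup>2 / 2)))"
    by (rule gaussian_mean_fourier[OF g])
  also have "\<dots> = (LINT y|lborel. g y * (sqrt (2 * pi) / t * (LINT u|?\<mu>. g (y + u / t))))"
  proof (intro Bochner_Integration.integral_cong refl arg_cong2[where f="(*)"])
    fix y :: real
    have "(LINT x|lborel. g x * exp (- ((y - x) * t)\<^sup>2 / 2))
      = 1 / t * (LINT u|lborel. g (y + u / t) * exp (- u\<^sup>2 / 2))"
      using t by (subst lborel_integral_real_affine[where c="1/t" and t=y]) auto
    also have "(LINT u|lborel. g (y + u / t) * exp (- u\<^sup>2 / 2))
      = (LINT u|lborel. sqrt (2 * pi) * (std_normal_density u * g (y + u / t)))"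
      by (intro Bochner_Integration.integral_cong refl, subst dens[symmetric]) (simp only: mult_ac)
    also have "\<dots> = sqrt (2 * pi) * (LINT u|?\<mu>. g (y + u / t))"
      by (simp add: integral_density)
    finally show "(LINT x|lborel. g x * exp (- ((y - x) * t)\<^sup>2 / 2))
      = sqrt (2 * pi) / t * (LINT u|?\<mu>. g (y + u / t))"
      by simp
  qed
  also have "\<dots> = sqrt (2 * pi) / t * (LINT y|lborel. g y * (LINT u|?\<mu>. g (y + u / t)))"
    by (simp add: mult.left_commute[of _ "sqrt (2 * pi) / t"] del: times_divide_eq_left times_divide_eq_right)
  finally show ?thesis
    using t real_sqrt_mult_self[of "2 * pi"]
    by (simp add: mult.assoc[symmetric] flip: ennreal_mult' del: real_sqrt_mult real_sqrt_mult_self)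
qed

text \<open>Only the case of a bounded, compactly supported function with finitely many discontinuities is
  needed. There the smoothed function converges to \<open>g\<close> almost everywhere.\<close>

lemma plancherel:
  assumes g: "bounded_cpt_supp g" and S: "finite S" "\<And>x. x \<notin> S \<Longrightarrow> isCont g x"
  shows "(\<integral>\<^sup>+\<omega>. ennreal ((cmod (fourier (\<lambda>x. complex_of_real (g x)) \<omega>))\<^sup>2) \<partial>lborel)
    = ennreal (2 * pi * (LINT x|lborel. (g x)\<^sup>2))"
proof -
  let ?\<mu> = "std_normal_distribution"
  let ?h = "fourier (\<lambda>x. complex_of_real (g x))"
  interpret \<mu>: prob_space ?\<mu>
    using real_dist_normal_dist by (simp add: real_distribution_def)
  obtain M R where gb: "0 < M" "0 < R" "\<And>x. \<bar>g x\<bar> \<le> M" "\<And>x. R < \<bar>x\<bar> \<Longrightarrow> g x = 0"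
    and [measurable]: "g \<in> borel_measurable borel"
    using bounded_cpt_suppE[OF g] by metis
  define J where "J n = (LINT y|lborel. g y * (LINT u|?\<mu>. g (y + u / real (Suc n))))" for n
  define I where "I n = (\<integral>\<^sup>+\<omega>. ennreal ((cmod (?h \<omega>))\<^sup>2 * exp (- (\<omega> / real (Suc n))\<^sup>2 / 2)) \<partial>lborel)" for n
  have scale: "(\<lambda>n. c / real (Suc n)) \<longlonglongrightarrow> 0" for c
    using tendsto_mult[OF tendsto_const[of c] LIMSEQ_inverse_real_of_nat] by (simp add: divide_inverse)
  have I_eq: "I n = ennreal (2 * pi * J n)" for n
    unfolding I_def J_def by (rule plancherel_gaussian[OF g]) simp
  have inner: "(\<lambda>n. LINT u|?\<mu>. g (y + u / real (Suc n))) \<longlonglongrightarrow> g y" if "y \<notin> S" for y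
  proof -
    have "(\<lambda>n. LINT u|?\<mu>. g (y + u / real (Suc n))) \<longlonglongrightarrow> (LINT u|?\<mu>. g y)"
    proof (rule integral_dominated_convergence[where w="\<lambda>_. M"])
      show "AE u in ?\<mu>. (\<lambda>n. g (y + u / real (Suc n))) \<longlonglongrightarrow> g y"
      proof (intro AE_I2 isCont_tendsto_compose[OF S(2)[OF that]])
        show "(\<lambda>n. y + u / real (Suc n)) \<longlonglongrightarrow> y" for u
          using tendsto_add[OF tendsto_const[of y] scale[of u]] by simp
      qed
    qed (use gb in auto)
    moreover have "(LINT u|?\<mu>. g y) = g y"
      using \<mu>.prob_space by simp
    ultimately show ?thesis by (simp only:)
  qed
  have bound: "\<bar>LINT u|?\<mu>. g (y + u / real (Suc n))\<bar> \<le> M" for y n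
  proof -
    have "\<bar>LINT u|?\<mu>. g (y + u / real (Suc n))\<bar> \<le> (LINT u|?\<mu>. \<bar>g (y + u / real (Suc n))\<bar>)"
      by (rule integral_abs_bound)
    also have "\<dots> \<le> (LINT u|?\<mu>. M)"
      by (rule integral_mono_AE') (use gb in \<open>auto intro!: AE_I2 order_less_imp_le\<close>)
    also have "\<dots> = M"
      using \<mu>.prob_space by simp
    finally show ?thesis .
  qed
  have "J \<longlonglongrightarrow> (LINT y|lborel. g y * g y)"
    unfolding J_def
  proof (rule integral_dominated_convergence[where w="\<lambda>y. M * \<bar>g y\<bar>"])
    show "integrable lborel (\<lambda>y. M * \<bar>g y\<bar>)"
      using bounded_cpt_supp_integrable[OF g] by auto
    have "AE y in lborel. y \<notin> S"
      by (intro AE_not_in finite_imp_null_set_lborel S)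
    then show "AE y in lborel. (\<lambda>n. g y * (LINT u|?\<mu>. g (y + u / real (Suc n)))) \<longlonglongrightarrow> g y * g y"
      by eventually_elim (intro tendsto_intros inner)
    show "AE y in lborel. norm (g y * (LINT u|?\<mu>. g (y + u / real (Suc n)))) \<le> M * \<bar>g y\<bar>" for n
      using bound by (auto intro!: AE_I2 simp: abs_mult mult.commute[of M] intro!: mult_left_mono)
  qed measurable
  then have "I \<longlonglongrightarrow> ennreal (2 * pi * (LINT x|lborel. (g x)\<^sup>2))"
    unfolding I_eq power2_eq_square by (intro tendsto_ennrealI tendsto_mult_left)
  moreover have "I \<longlonglongrightarrow> (\<integral>\<^sup>+\<omega>. ennreal ((cmod (?h \<omega>))\<^sup>2) \<partial>lborel)"
    unfolding I_def
  proof (rule nn_integral_LIMSEQ)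
    show "incseq (\<lambda>n \<omega>. ennreal ((cmod (?h \<omega>))\<^sup>2 * exp (- (\<omega> / real (Suc n))\<^sup>2 / 2)))"
    proof (rule incseq_SucI, rule le_funI, rule ennreal_leI, rule mult_left_mono)
      fix n and \<omega> :: real
      have "\<bar>\<omega> / real (Suc (Suc n))\<bar> \<le> \<bar>\<omega> / real (Suc n)\<bar>"
        by (auto simp: abs_divide intro!: divide_left_mono)
      then show "exp (- (\<omega> / real (Suc n))\<^sup>2 / 2) \<le> exp (- (\<omega> / real (Suc (Suc n)))\<^sup>2 / 2)"
        unfolding abs_le_square_iff by simp
    qed simp
    show "(\<lambda>n. ennreal ((cmod (?h \<omega>))\<^sup>2 * exp (- (\<omega> / real (Suc n))\<^sup>2 / 2)))
        \<longlonglongrightarrow> ennreal ((cmod (?h \<omega>))\<^sup>2)" for \<omega>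
    proof -
      have "(\<lambda>n. (cmod (?h \<omega>))\<^sup>2 * exp (- (\<omega> / real (Suc n))\<^sup>2 / 2))
          \<longlonglongrightarrow> (cmod (?h \<omega>))\<^sup>2 * exp (- 0\<^sup>2 / 2)"
        by (intro tendsto_intros scale) auto
      then show ?thesis by (intro tendsto_ennrealI) simp
    qed
  qed measurable
  ultimately show ?thesis
    using LIMSEQ_unique by blast
qed


section \<open>Frequency variance and Dirichlet integral\<close>

text \<open>\<open>f\<close> is continuous with compact support and \<open>g\<close> is its derivative off a finite
  set, on whose complement \<open>g\<close> is continuous; \<open>g\<close> is bounded with compact support.
  The derivative is a separate argument because its values on the exceptional set are irrelevant.\<close>

definition pw_C1 :: "(real \<Rightarrow> real) \<Rightarrow> (real \<Rightarrow> real) \<Rightarrow> bool" where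
  "pw_C1 f g \<longleftrightarrow> continuous_on UNIV f \<and> bounded_cpt_supp f \<and> bounded_cpt_supp g
     \<and> (\<exists>S. finite S \<and> (\<forall>x. x \<notin> S \<longrightarrow> (f has_real_derivative g x) (at x) \<and> isCont g x))"

lemma fourier_derivative:
  assumes "pw_C1 f g"
  shows "fourier (\<lambda>x. complex_of_real (g x)) \<omega>
    = \<i> * complex_of_real \<omega> * fourier (\<lambda>x. complex_of_real (f x)) \<omega>"
proof -
  have f: "continuous_on UNIV f" "bounded_cpt_supp f" and g: "bounded_cpt_supp g"
    using assms by (auto simp: pw_C1_def)
  obtain S where S: "finite S" "\<And>x. x \<notin> S \<Longrightarrow> (f has_real_derivative g x) (at x)"
    using assms by (auto simp: pw_C1_def)
  obtain R1 where R1: "\<And>x. R1 < \<bar>x\<bar> \<Longrightarrow> f x = 0"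
    using f(2) by (auto simp: bounded_cpt_supp_def)
  obtain R2 where R2: "\<And>x. R2 < \<bar>x\<bar> \<Longrightarrow> g x = 0"
    using g by (auto simp: bounded_cpt_supp_def)
  \<comment> \<open>The extra \<open>1\<close> makes \<open>f\<close> vanish at the endpoints \<open>- R\<close> and \<open>R\<close> themselves.\<close>
  define R where "R = \<bar>R1\<bar> + \<bar>R2\<bar> + 1"
  have R: "0 < R" "\<And>x. R \<le> \<bar>x\<bar> \<Longrightarrow> f x = 0" "\<And>x. R \<le> \<bar>x\<bar> \<Longrightarrow> g x = 0"
    unfolding R_def by (auto intro!: R1 R2)
  define E where "E x = exp (- \<i> * complex_of_real \<omega> * complex_of_real x)" for x :: real
  define h where "h x = E x * complex_of_real (f x)" for x
  define h' where "h' x = E x * complex_of_real (g x) - \<i> * complex_of_real \<omega> * (E x * complex_of_real (f x))" for x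
  have nE: "norm (E x) = 1" for x
    unfolding E_def by simp
  have [measurable]: "E \<in> borel_measurable borel"
    unfolding E_def by measurable
  have [measurable]: "f \<in> borel_measurable borel" "g \<in> borel_measurable borel"
    using f(2) g by (simp_all add: bounded_cpt_supp_borel)
  have int: "integrable lborel (\<lambda>x. E x * complex_of_real (u x))" if "bounded_cpt_supp u" for u
  proof (rule Bochner_Integration.integrable_bound[OF bounded_cpt_supp_integrable[OF that]])
    have [measurable]: "u \<in> borel_measurable borel"
      using that by (rule bounded_cpt_supp_borel)
    show "(\<lambda>x. E x * complex_of_real (u x)) \<in> borel_measurable lborel"
      by measurable
  qed (simp add: norm_mult nE)
  have "integral\<^sup>L lborel h' = (LINT x:{-R..R}|lborel. h' x)"
    unfolding set_lebesgue_integral_def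
    by (intro Bochner_Integration.integral_cong refl)
       (use R in \<open>force simp: h'_def indicator_def abs_if split: if_splits\<close>)
  also have "\<dots> = integral {-R..R} h'"
  proof (rule set_borel_integral_eq_integral)
    have "integrable lborel h'"
      unfolding h'_def by (intro Bochner_Integration.integrable_diff integrable_mult_right int f g)
    then show "set_integrable lborel {-R..R} h'"
      unfolding set_integrable_def by (intro integrable_mult_indicator) auto
  qed
  also have "\<dots> = h R - h (- R)"
  proof (rule integral_unique, rule fundamental_theorem_of_calculus_interior_strong[OF S(1)])
    show "(h has_vector_derivative h' x) (at x)" if "x \<in> {-R<..<R} - S" for x
    proof -
      have 1: "(E has_vector_derivative (- \<i> * complex_of_real \<omega> * E x)) (at x)"
        unfolding E_def by (rule has_vector_derivative_real_field) (auto intro!: derivative_eq_intros)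
      have 2: "((\<lambda>x. complex_of_real (f x)) has_vector_derivative complex_of_real (g x)) (at x)"
        using S(2)[of x] that
        by (intro has_vector_derivative_of_real) (auto simp: has_real_derivative_iff_has_vector_derivative)
      show ?thesis
        unfolding h_def h'_def
        using has_vector_derivative_mult[OF 1 2] by (simp add: algebra_simps)
    qed
    show "continuous_on {-R..R} h"
      unfolding h_def E_def
      by (intro continuous_intros continuous_on_subset[OF f(1)]) auto
  qed (use R in auto)
  also have "\<dots> = 0"
    using R by (simp add: h_def)
  finally have "(LINT x|lborel. h' x) = 0" .
  then show ?thesis
    unfolding h'_def fourier_def E_def[symmetric]
    by (subst (asm) Bochner_Integration.integral_diff) (auto intro!: int f g simp: integral_mult_right_zero)
qed

lemma integral_odd_zero:
  fixes v :: "real \<Rightarrow> real"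
  assumes "\<And>x. v (- x) = - v x"
  shows "(LINT x|lborel. v x) = 0"
proof -
  have "(LINT x|lborel. v x) = (LINT x|lborel. v (- x))"
    using lborel_integral_real_affine[of "-1" v 0] by simp
  then show ?thesis
    by (simp add: assms)
qed

lemma freq_mean_real: "freq_mean (\<lambda>x. complex_of_real (f x)) = 0"
proof -
  let ?F = "fourier (\<lambda>x. complex_of_real (f x))"
  have "?F (- \<omega>) = cnj (?F \<omega>)" for \<omega>
    unfolding cnj_fourier_real by (simp add: fourier_def mult.assoc)
  then show ?thesis
    unfolding freq_mean_def by (subst integral_odd_zero) auto
qed

lemma L2_norm_sq_real: "L2_norm_sq (\<lambda>x. complex_of_real (f x)) = (LINT x|lborel. (f x)\<^sup>2)"
  by (simp add: L2_norm_sq_def)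

lemma spatial_variance_real:
  fixes f :: "real \<Rightarrow> real"
  defines "F \<equiv> (\<lambda>x. complex_of_real (f x))"
  shows "spatial_variance F = (LINT x|lborel. (x - barycenter F)\<^sup>2 * (f x)\<^sup>2) / (LINT x|lborel. (f x)\<^sup>2)"
  by (simp add: spatial_variance_def L2_norm_sq_def F_def)

text \<open>For a real function the mean frequency is \<open>0\<close>, so the frequency variance is the Dirichlet
  integral divided by the mass.\<close>

lemma freq_variance_pw_C1:
  assumes fg: "pw_C1 f g"
  shows "freq_variance (\<lambda>x. complex_of_real (f x))
    = ennreal ((LINT x|lborel. (g x)\<^sup>2) / (LINT x|lborel. (f x)\<^sup>2))"
proof -
  obtain S where S: "finite S" "\<And>x. x \<notin> S \<Longrightarrow> isCont g x"
    using fg by (auto simp: pw_C1_def)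
  have g: "bounded_cpt_supp g"
    using fg by (simp add: pw_C1_def)
  \<comment> \<open>Multiplication by \<open>\<i> \<omega>\<close> is differentiation, so the second moment in frequency is the squared norm of the transform of \<open>g\<close>.\<close>
  have "(\<integral>\<^sup>+\<omega>. ennreal (\<omega>\<^sup>2 * (cmod (fourier (\<lambda>x. complex_of_real (f x)) \<omega>))\<^sup>2) \<partial>lborel)
    = (\<integral>\<^sup>+\<omega>. ennreal ((cmod (fourier (\<lambda>x. complex_of_real (g x)) \<omega>))\<^sup>2) \<partial>lborel)"
    unfolding fourier_derivative[OF fg] by (simp add: norm_mult power_mult_distrib)
  also have "\<dots> = ennreal (2 * pi * (LINT x|lborel. (g x)\<^sup>2))"
    using plancherel[OF g S] .
  finally show ?thesis
    unfolding freq_variance_def freq_mean_real L2_norm_sq_real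
    by (simp flip: ennreal_mult)
qed


section \<open>Half-line integrals and reflections\<close>

text \<open>For \<open>s = 1\<close> this is the integral of \<open>u\<close> over the half-line to the right of \<open>c\<close>, and for \<open>s = - 1\<close>
  the one over the half-line to the left. Parametrising both by \<open>y \<ge> 0\<close> lets one proof serve the
  two reflections.\<close>

definition half_integral :: "real \<Rightarrow> real \<Rightarrow> (real \<Rightarrow> real) \<Rightarrow> real" where
  "half_integral c s u = (LINT y:{0..}|lborel. u (c + s * y))"

lemma integral_split_zero:
  fixes v :: "real \<Rightarrow> real"
  assumes "integrable lborel v"
  shows "(LINT y|lborel. v y) = (LINT y:{0..}|lborel. v y) + (LINT y:{0..}|lborel. v (- y))"
proof -
  have v [measurable]: "v \<in> borel_measurable borel"
    using assms by simp
  have "(LINT y|lborel. v y) = (LINT y|lborel. indicator {0..} y * v y + indicator {0..} (- y) * v y)"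
    by (rule integral_cong_AE) (use AE_lborel_singleton[of "0::real"] in \<open>auto simp: indicator_def elim!: eventually_mono\<close>)
  also have "\<dots> = (LINT y|lborel. indicator {0..} y * v y) + (LINT y|lborel. indicator {0..} (- y) * v y)"
    by (rule Bochner_Integration.integral_add; rule Bochner_Integration.integrable_bound[OF assms])
       (auto simp: indicator_def)
  also have "(LINT y|lborel. indicator {0..} (- y) * v y) = (LINT y|lborel. indicator {0..} y * v (- y))"
    by (subst lborel_integral_real_affine[where c="-1" and t=0]) auto
  finally show ?thesis
    by (simp add: set_lebesgue_integral_def)
qed

lemma integrable_shift:
  assumes "integrable lborel (u :: real \<Rightarrow> real)" "s = 1 \<or> s = - 1"
  shows "integrable lborel (\<lambda>y. u (c + s * y))"
  using assms lborel_integrable_real_affine[of u s c] by auto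

lemma integral_eq_half_integrals:
  assumes "integrable lborel u"
  shows "(LINT x|lborel. u x) = half_integral c 1 u + half_integral c (- 1) u"
proof -
  have "(LINT x|lborel. u x) = (LINT y|lborel. u (c + y))"
    using lborel_integral_real_affine[of 1 u c] by simp
  also have "\<dots> = half_integral c 1 u + half_integral c (- 1) u"
    using integral_split_zero[of "\<lambda>y. u (c + y)"] integrable_shift[OF assms, of 1 c]
    by (simp add: half_integral_def)
  finally show ?thesis .
qed

text \<open>The even reflection about \<open>c\<close> of the right half (\<open>s = 1\<close>) or of the left half (\<open>s = - 1\<close>) of \<open>u\<close>.\<close>

definition reflect :: "real \<Rightarrow> real \<Rightarrow> (real \<Rightarrow> real) \<Rightarrow> real \<Rightarrow> real" where
  "reflect c s u x = u (c + s * \<bar>x - c\<bar>)"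

lemma bounded_cpt_supp_reflect:
  assumes "bounded_cpt_supp u" "s = 1 \<or> s = - 1"
  shows "bounded_cpt_supp (reflect c s u)"
proof -
  obtain M R where u: "\<And>x. \<bar>u x\<bar> \<le> M" "\<And>x. R < \<bar>x\<bar> \<Longrightarrow> u x = 0"
    and [measurable]: "u \<in> borel_measurable borel"
    using bounded_cpt_suppE[OF assms(1)] by metis
  show ?thesis
  proof (rule bounded_cpt_suppI)
    show "reflect c s u \<in> borel_measurable borel"
      unfolding reflect_def by measurable
    show "\<bar>reflect c s u x\<bar> \<le> M" for x
      using u(1) by (simp add: reflect_def)
    show "reflect c s u x = 0" if "R + 2 * \<bar>c\<bar> < \<bar>x\<bar>" for x
      unfolding reflect_def by (rule u(2)) (use that assms(2) in \<open>auto simp: abs_if split: if_splits\<close>)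
  qed
qed

lemma integral_reflect:
  assumes "bounded_cpt_supp u" "s = 1 \<or> s = - 1"
  shows "(LINT x|lborel. reflect c s u x) = 2 * half_integral c s u"
proof -
  have "(LINT x|lborel. reflect c s u x)
      = half_integral c 1 (reflect c s u) + half_integral c (- 1) (reflect c s u)"
    by (rule integral_eq_half_integrals bounded_cpt_supp_integrable bounded_cpt_supp_reflect assms)+
  also have "half_integral c 1 (reflect c s u) = half_integral c s u"
    unfolding half_integral_def reflect_def by (rule set_lebesgue_integral_cong) auto
  also have "half_integral c (- 1) (reflect c s u) = half_integral c s u"
    unfolding half_integral_def reflect_def by (rule set_lebesgue_integral_cong) auto
  finally show ?thesis by simp
qed

lemma pw_C1_reflect:
  assumes fg: "pw_C1 f g" and s: "s = 1 \<or> s = - 1"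
  shows "pw_C1 (reflect c s f) (\<lambda>x. s * sgn (x - c) * reflect c s g x)"
proof -
  obtain S where S: "finite S" "\<And>x. x \<notin> S \<Longrightarrow> (f has_real_derivative g x) (at x)"
     "\<And>x. x \<notin> S \<Longrightarrow> isCont g x"
    using fg by (auto simp: pw_C1_def)
  have f: "continuous_on UNIV f" "bounded_cpt_supp f" and g: "bounded_cpt_supp g"
    using fg by (auto simp: pw_C1_def)
  \<comment> \<open>The folded argument meets \<open>S\<close> only at points of \<open>S\<close> or their mirror images; the kink is at \<open>c\<close>.\<close>
  define T where "T = insert c (S \<union> (\<lambda>x. 2 * c - x) ` S)"
  have "finite T"
    using S(1) by (simp add: T_def)
  have T: "x \<noteq> c" "c + s * \<bar>x - c\<bar> \<notin> S" if "x \<notin> T" for x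
  proof -
    show "x \<noteq> c" using that by (simp add: T_def)
    have "x \<notin> S" "2 * c - x \<notin> S"
      using that by (auto simp: T_def image_iff)
    then show "c + s * \<bar>x - c\<bar> \<notin> S"
      using s by (auto simp: abs_if algebra_simps split: if_splits)
  qed
  have "continuous_on UNIV (reflect c s f)"
    unfolding reflect_def by (intro continuous_on_compose2[OF f(1)] continuous_intros) auto
  moreover have "bounded_cpt_supp (\<lambda>x. s * sgn (x - c) * reflect c s g x)"
  proof -
    obtain M R where u: "0 < M" "\<And>x. \<bar>reflect c s g x\<bar> \<le> M" "\<And>x. R < \<bar>x\<bar> \<Longrightarrow> reflect c s g x = 0"
      and [measurable]: "reflect c s g \<in> borel_measurable borel"
      using bounded_cpt_suppE[OF bounded_cpt_supp_reflect[OF g s]] by metis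
    show ?thesis
    proof (rule bounded_cpt_suppI[where M=M and R=R])
      show "\<bar>s * sgn (x - c) * reflect c s g x\<bar> \<le> M" for x
        using u(1,2) s by (auto simp: abs_mult abs_sgn_eq)
    qed (use u in auto)
  qed
  moreover have "(reflect c s f has_real_derivative s * sgn (x - c) * reflect c s g x) (at x)
     \<and> isCont (\<lambda>x. s * sgn (x - c) * reflect c s g x) x" if "x \<notin> T" for x
  proof
    have abs: "((\<lambda>x. \<bar>x - c\<bar>) has_real_derivative sgn (x - c)) (at x)"
    proof (rule has_field_derivative_transform_within_open)
      show "((\<lambda>y. sgn (x - c) * (y - c)) has_real_derivative sgn (x - c)) (at x)"
        by (auto intro!: derivative_eq_intros)
      show "open (if c < x then {c<..} else {..<c})" by simp
    qed (use T(1)[OF that] in \<open>auto split: if_splits\<close>)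
    have "((\<lambda>x. c + s * \<bar>x - c\<bar>) has_real_derivative s * sgn (x - c)) (at x)"
      by (rule derivative_eq_intros abs refl)+ simp
    from DERIV_chain2[OF S(2)[OF T(2)[OF that]] this]
    show "(reflect c s f has_real_derivative s * sgn (x - c) * reflect c s g x) (at x)"
      unfolding reflect_def by (simp add: mult.commute)
    have "isCont (\<lambda>x. c + s * \<bar>x - c\<bar>) x"
      by (intro continuous_intros)
    then have "isCont (reflect c s g) x"
      unfolding reflect_def by (rule isCont_o2) (rule S(3)[OF T(2)[OF that]])
    then show "isCont (\<lambda>x. s * sgn (x - c) * reflect c s g x) x"
      using T(1)[OF that] by (intro continuous_intros) auto
  qed
  ultimately show ?thesis
    unfolding pw_C1_def
    using \<open>finite T\<close> bounded_cpt_supp_reflect[OF f(2) s] by blast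
qed

text \<open>A reflected function has barycenter \<open>c\<close>, and passing to it doubles each of the three half-line
  integrals, so that both variances are quotients of half-line integrals of \<open>f\<close>.\<close>

lemma reflect_variances:
  fixes f :: "real \<Rightarrow> real"
  assumes fg: "pw_C1 f g" and s: "s = 1 \<or> s = - 1"
    and pos: "half_integral c s (\<lambda>x. (f x)\<^sup>2) > 0"
  defines "F \<equiv> (\<lambda>x. complex_of_real (reflect c s f x))"
  shows "spatial_variance F
      = half_integral c s (\<lambda>x. (x - c)\<^sup>2 * (f x)\<^sup>2) / half_integral c s (\<lambda>x. (f x)\<^sup>2)" (is ?S)
    and "freq_variance F
      = ennreal (half_integral c s (\<lambda>x. (g x)\<^sup>2) / half_integral c s (\<lambda>x. (f x)\<^sup>2))" (is ?W)
proof -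
  have f: "continuous_on UNIV f" "bounded_cpt_supp f" and g: "bounded_cpt_supp g"
    using fg by (auto simp: pw_C1_def)
  have sq: "bounded_cpt_supp (\<lambda>x. (f x)\<^sup>2)" "bounded_cpt_supp (\<lambda>x. (g x)\<^sup>2)"
    using f g by (auto intro: bounded_cpt_supp_square)
  have mom: "bounded_cpt_supp (\<lambda>x. (x - c)\<^sup>2 * (f x)\<^sup>2)"
    by (intro bounded_cpt_supp_mult sq continuous_intros)
  have N: "(LINT x|lborel. (reflect c s f x)\<^sup>2) = 2 * half_integral c s (\<lambda>x. (f x)\<^sup>2)"
    using integral_reflect[OF sq(1) s, of c] by (simp add: reflect_def)
  have bar: "barycenter F = c"
  proof -
    have rsq: "bounded_cpt_supp (\<lambda>x. (reflect c s f x)\<^sup>2)"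
      by (intro bounded_cpt_supp_square bounded_cpt_supp_reflect f s)
    have "(LINT x|lborel. (x - c) * (reflect c s f x)\<^sup>2)
        = (LINT y|lborel. y * (reflect c s f (c + y))\<^sup>2)"
      by (subst lborel_integral_real_affine[where c=1 and t=c]) auto
    also have "\<dots> = 0"
      by (rule integral_odd_zero) (simp add: reflect_def)
    also have "(LINT x|lborel. (x - c) * (reflect c s f x)\<^sup>2)
        = (LINT x|lborel. x * (reflect c s f x)\<^sup>2) - (LINT x|lborel. c * (reflect c s f x)\<^sup>2)"
      unfolding left_diff_distrib
      by (intro Bochner_Integration.integral_diff bounded_cpt_supp_integrable bounded_cpt_supp_mult rsq continuous_intros)
    finally have "(LINT x|lborel. x * (reflect c s f x)\<^sup>2) = c * (LINT x|lborel. (reflect c s f x)\<^sup>2)"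
      by simp
    then show ?thesis
      unfolding barycenter_def F_def L2_norm_sq_real using pos N by simp
  qed
  have "(x - c)\<^sup>2 * (reflect c s f x)\<^sup>2 = reflect c s (\<lambda>x. (x - c)\<^sup>2 * (f x)\<^sup>2) x" for x
    using s by (auto simp: reflect_def)
  then show ?S
    unfolding F_def spatial_variance_real bar[unfolded F_def] N
    by (simp add: integral_reflect[OF mom s])
  have "(LINT x|lborel. (s * sgn (x - c) * reflect c s g x)\<^sup>2) = (LINT x|lborel. reflect c s (\<lambda>x. (g x)\<^sup>2) x)"
  proof (rule integral_cong_AE)
    show "AE x in lborel. (s * sgn (x - c) * reflect c s g x)\<^sup>2 = reflect c s (\<lambda>x. (g x)\<^sup>2) x"
      using AE_lborel_singleton[of c]
      by eventually_elim (use s in \<open>auto simp: reflect_def power_mult_distrib sgn_if\<close>)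
  qed (use pw_C1_reflect[OF fg s, of c] bounded_cpt_supp_reflect[OF sq(2) s, of c] in
      \<open>auto simp: pw_C1_def bounded_cpt_supp_borel intro!: borel_measurable_power\<close>)
  then show ?W
    unfolding F_def freq_variance_pw_C1[OF pw_C1_reflect[OF fg s]] N
    by (simp add: integral_reflect[OF sq(2) s])
qed


section \<open>Positivity of the half masses\<close>

lemma half_integral_zero_AE:
  assumes "bounded_cpt_supp u" "s = 1 \<or> s = - 1" "\<And>y. 0 \<le> y \<Longrightarrow> 0 \<le> u (c + s * y)"
    and "half_integral c s u = 0"
  shows "AE y in lborel. 0 \<le> y \<longrightarrow> u (c + s * y) = 0"
proof -
  have "integrable lborel (\<lambda>y. indicator {0..} y *\<^sub>R u (c + s * y))"
    using integrable_shift[OF bounded_cpt_supp_integrable[OF assms(1)] assms(2), of c]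
    by (intro integrable_mult_indicator) auto
  then have "AE y in lborel. indicator {0..} y *\<^sub>R u (c + s * y) = 0"
    using assms(3,4) integral_nonneg_eq_0_iff_AE[of lborel "\<lambda>y. indicator {0..} y *\<^sub>R u (c + s * y)"]
    by (auto simp: half_integral_def set_lebesgue_integral_def indicator_def)
  then show ?thesis
    by eventually_elim (auto simp: indicator_def split: if_splits)
qed

lemma half_integral_eq_0_AE:
  assumes "AE y in lborel. 0 \<le> y \<longrightarrow> u (c + s * y) = 0"
  shows "half_integral c s u = 0"
  unfolding half_integral_def set_lebesgue_integral_def
  by (rule integral_eq_zero_AE) (use assms in \<open>auto elim!: eventually_mono simp: indicator_def\<close>)

lemma L2_pos:
  assumes "continuous_on UNIV f" "bounded_cpt_supp f" "f x0 \<noteq> (0::real)"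
  shows "(LINT x|lborel. (f x)\<^sup>2) > 0"
proof (rule ccontr)
  assume "\<not> ?thesis"
  moreover have "(LINT x|lborel. (f x)\<^sup>2) \<ge> 0" by simp
  ultimately have "(LINT x|lborel. (f x)\<^sup>2) = 0" by simp
  then have "AE x in lborel. (f x)\<^sup>2 = 0"
    by (subst (asm) integral_nonneg_eq_0_iff_AE)
       (auto intro!: bounded_cpt_supp_integrable bounded_cpt_supp_square assms)
  then have "AE x in lborel. x \<notin> {x. f x \<noteq> 0}"
    by eventually_elim simp
  moreover have op: "open {x. f x \<noteq> 0}"
    using assms(1) by (intro open_Collect_neq) auto
  ultimately have "{x. f x \<noteq> 0} \<in> null_sets lborel"
    by (subst AE_iff_null_sets) auto
  then have "negligible {x. f x \<noteq> 0}"
    by (metis negligible_iff_null_sets null_sets_completionI)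
  with open_not_negligible[OF op] assms(3) show False by auto
qed

text \<open>If one side of the barycenter carried no mass, then the first moment about the barycenter, which
  is \<open>0\<close>, would be an integral of a function of constant sign, and the other side would carry no
  mass either.\<close>

lemma half_mass_pos:
  fixes f :: "real \<Rightarrow> real"
  assumes f: "continuous_on UNIV f" "bounded_cpt_supp f" "f x0 \<noteq> 0"
    and s: "s = 1 \<or> s = - 1" and c: "c = barycenter (\<lambda>x. complex_of_real (f x))"
  shows "half_integral c s (\<lambda>x. (f x)\<^sup>2) > 0"
proof (rule ccontr)
  assume neg: "\<not> ?thesis"
  let ?u = "\<lambda>x. (f x)\<^sup>2" and ?v = "\<lambda>x. (x - c) * (f x)\<^sup>2"
  have u: "bounded_cpt_supp ?u"
    using f by (intro bounded_cpt_supp_square)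
  have v: "bounded_cpt_supp ?v"
    by (intro bounded_cpt_supp_mult u continuous_intros)
  have pos: "(LINT x|lborel. ?u x) > 0"
    by (rule L2_pos[OF f])
  have "half_integral c s ?u \<ge> 0"
    by (simp add: half_integral_def set_lebesgue_integral_def)
  with neg have z: "half_integral c s ?u = 0" by simp
  then have "AE y in lborel. 0 \<le> y \<longrightarrow> ?u (c + s * y) = 0"
    by (intro half_integral_zero_AE u s) auto
  then have "half_integral c s ?v = 0"
    by (intro half_integral_eq_0_AE) (auto elim!: eventually_mono)
  moreover have "half_integral c s ?v + half_integral c (- s) ?v = 0"
  proof -
    have "half_integral c s ?v + half_integral c (- s) ?v = (LINT x|lborel. ?v x)"
      using s integral_eq_half_integrals[OF bounded_cpt_supp_integrable[OF v], of c] by auto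
    also have "\<dots> = (LINT x|lborel. x * (f x)\<^sup>2) - (LINT x|lborel. c * (f x)\<^sup>2)"
      unfolding left_diff_distrib
      by (intro Bochner_Integration.integral_diff bounded_cpt_supp_integrable bounded_cpt_supp_mult u continuous_intros)
    also have "\<dots> = 0"
      using pos unfolding c barycenter_def L2_norm_sq_real by simp
    finally show ?thesis .
  qed
  \<comment> \<open>The factor \<open>- s\<close> makes the integrand nonnegative on the remaining half-line.\<close>
  ultimately have "half_integral c (- s) (\<lambda>x. - s * ?v x) = 0"
    unfolding half_integral_def set_lebesgue_integral_def by (simp add: mult.left_commute[of _ s])
  then have "AE y in lborel. 0 \<le> y \<longrightarrow> - s * ?v (c + (- s) * y) = 0"
    using s by (intro half_integral_zero_AE bounded_cpt_supp_mult v continuous_intros) auto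
  then have "AE y in lborel. 0 \<le> y \<longrightarrow> ?u (c + (- s) * y) = 0"
    using AE_lborel_singleton[of 0] by eventually_elim (use s in auto)
  then have "half_integral c (- s) ?u = 0"
    by (rule half_integral_eq_0_AE)
  with z have "(LINT x|lborel. ?u x) = 0"
    using s integral_eq_half_integrals[OF bounded_cpt_supp_integrable[OF u], of c] by auto
  with pos show False by simp
qed


section \<open>Regularity of continuous piecewise polynomials\<close>

lemma eventually_indicator_atLeastLessThan:
  fixes x l r :: real
  assumes "x \<noteq> l" "x \<noteq> r"
  shows "\<forall>\<^sub>F y in nhds x. indicator {l..<r} y = (indicator {l..<r} x :: real)"
proof -
  have "\<forall>\<^sub>F y in nhds x. (l \<le> y \<longleftrightarrow> l \<le> x)"
    using assms(1) eventually_nhds_in_open[of "{..<l}" x] eventually_nhds_in_open[of "{l<..}" x]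
    by (cases "x < l") (auto elim!: eventually_mono)
  moreover have "\<forall>\<^sub>F y in nhds x. (y < r \<longleftrightarrow> x < r)"
    using assms(2) eventually_nhds_in_open[of "{..<r}" x] eventually_nhds_in_open[of "{r<..}" x]
    by (cases "x < r") (auto elim!: eventually_mono)
  ultimately show ?thesis
    by eventually_elim (simp add: indicator_def)
qed

lemma tendsto_right_indicator_atLeastLessThan:
  fixes x l r :: real
  shows "(indicator {l..<r} \<longlongrightarrow> (indicator {l..<r} x :: real)) (at_right x)"
proof -
  have "\<forall>\<^sub>F y in at_right x. (l \<le> y \<longleftrightarrow> l \<le> x)"
    using eventually_nhds_in_open[of "{..<l}" x] eventually_at_right_less[of x]
    by (cases "x < l") (auto elim!: eventually_mono simp: eventually_at_filter)
  moreover have "\<forall>\<^sub>F y in at_right x. (y < r \<longleftrightarrow> x < r)"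
    using eventually_nhds_in_open[of "{..<r}" x] eventually_at_right_less[of x]
    by (cases "x < r") (auto elim!: eventually_mono simp: eventually_at_filter)
  ultimately have "\<forall>\<^sub>F y in at_right x. indicator {l..<r} y = (indicator {l..<r} x :: real)"
    by eventually_elim (simp add: indicator_def)
  then show ?thesis by (rule tendsto_eventually)
qed

text \<open>The pieces make \<open>f\<close> right-continuous everywhere; the prescribed left limits at the inner
  breakpoints and at \<open>a\<close>, and the value \<open>0\<close> at \<open>- a\<close>, give continuity on the whole line.\<close>

lemma F_0_plus_pw_C1:
  assumes "f \<in> F_0_plus a"
  obtains g where "pw_C1 f g"
proof -
  have "f \<in> F_supp a" and fa: "f (- a) = 0" "f a = 0"
    using assms by (auto simp: F_0_plus_def)
  then obtain n P l r where n: "1 \<le> n" "l 1 = - a" "r n = a"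
    and lr: "\<And>i. i \<in> {1..n} \<Longrightarrow> l i < r i" "\<And>i. i \<in> {1..<n} \<Longrightarrow> r i = l (Suc i)"
    and fx: "\<And>x. x \<noteq> a \<Longrightarrow> f x = (\<Sum>i=1..n. poly (P i) x * indicator {l i..<r i} x)"
    and lim: "\<And>i. i \<in> {2..n} \<Longrightarrow> (f \<longlongrightarrow> f (l i)) (at_left (l i))" "(f \<longlongrightarrow> f a) (at_left a)"
    unfolding F_supp_def by blast
  have la: "- a \<le> l i" if "i \<in> {1..n}" for i
  proof -
    have "1 \<le> i" "i \<le> n" using that by auto
    then show ?thesis
    proof (induction i rule: dec_induct)
      case (step m)
      then have "- a \<le> l m" "l m < r m" "r m = l (Suc m)" using lr(1,2)[of m] by auto
      then show ?case by simp
    qed (use n in simp)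
  qed
  have ra: "r i \<le> a" if "i \<in> {1..n}" for i
  proof -
    have "i \<le> n" "1 \<le> i" using that by auto
    then show ?thesis
    proof (induction i rule: inc_induct)
      case (step m)
      then have "l (Suc m) < r (Suc m)" "r (Suc m) \<le> a" "r m = l (Suc m)"
        using lr(1)[of "Suc m"] lr(2)[of m] by auto
      then show ?case by simp
    qed (use n in simp)
  qed
  \<comment> \<open>At \<open>a\<close> no piece contributes, in agreement with \<open>f a = 0\<close>, so the formula holds there too.\<close>
  have f_eq: "f x = (\<Sum>i=1..n. poly (P i) x * indicator {l i..<r i} x)" for x
  proof (cases "x = a")
    case True
    have "poly (P i) a * indicator {l i..<r i} a = 0" if "i \<in> {1..n}" for i
      using ra[OF that] by (auto simp: indicator_def)
    then have "(\<Sum>i=1..n. poly (P i) a * indicator {l i..<r i} a) = 0"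
      by (intro sum.neutral ballI)
    then show ?thesis
      by (simp only: True fa)
  qed (rule fx)
  define g where "g x = (\<Sum>i=1..n. indicator {l i..<r i} x * poly (pderiv (P i)) x)" for x
  define S where "S = l ` {1..n} \<union> r ` {1..n}"
  have ind: "bounded_cpt_supp (indicator {l i..<r i})" for i
    by (rule bounded_cpt_suppI[where M=1 and R="max \<bar>l i\<bar> \<bar>r i\<bar>"])
       (auto simp: indicator_def)
  have g: "bounded_cpt_supp g"
    unfolding g_def mult.commute[of "indicator _ _"]
    by (intro bounded_cpt_supp_sum bounded_cpt_supp_mult ind continuous_intros)
  have deriv: "(f has_real_derivative g x) (at x)" and "isCont g x" if "x \<notin> S" for x
  proof -
    have ev: "\<forall>\<^sub>F y in nhds x. \<forall>i\<in>{1..n}. indicator {l i..<r i} y = (indicator {l i..<r i} x :: real)"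
      by (intro eventually_ball_finite ballI eventually_indicator_atLeastLessThan)
         (use that in \<open>auto simp: S_def\<close>)
    have "\<forall>\<^sub>F y in nhds x. f y = (\<Sum>i=1..n. indicator {l i..<r i} x * poly (P i) y)"
      using ev by eventually_elim (auto simp: f_eq mult.commute intro!: sum.cong)
    moreover have "((\<lambda>y. \<Sum>i=1..n. indicator {l i..<r i} x * poly (P i) y) has_real_derivative g x) (at x)"
      unfolding g_def by (intro DERIV_sum DERIV_cmult poly_DERIV)
    ultimately show "(f has_real_derivative g x) (at x)"
      by (rule iffD2[OF DERIV_cong_ev[OF refl _ refl]])
    have "\<forall>\<^sub>F y in nhds x. g y = (\<Sum>i=1..n. indicator {l i..<r i} x * poly (pderiv (P i)) y)"
      using ev by eventually_elim (auto simp: g_def intro!: sum.cong)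
    moreover have "isCont (\<lambda>y. \<Sum>i=1..n. indicator {l i..<r i} x * poly (pderiv (P i)) y) x"
      by (intro continuous_intros)
    ultimately show "isCont g x"
      by (rule iffD2[OF isCont_cong])
  qed
  have "isCont f x" for x
  proof (cases "x \<in> S")
    case False
    then show ?thesis using deriv DERIV_isCont by blast
  next
    case True
    have "(f \<longlongrightarrow> f x) (at_right x)"
      unfolding f_eq
      by (intro tendsto_intros tendsto_right_indicator_atLeastLessThan)
    moreover have "(f \<longlongrightarrow> f x) (at_left x)"
    proof -
      consider "x = - a" | i where "i \<in> {2..n}" "x = l i" | "x = a"
      proof -
        from True obtain i where i: "i \<in> {1..n}" "x = l i \<or> x = r i"
          by (auto simp: S_def)
        have "i = 1 \<or> i \<in> {2..n}" "i = n \<or> i \<in> {1..<n} \<and> Suc i \<in> {2..n}"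
          using i(1) by auto
        then show thesis
          using that i(2) n lr(2)[of i] by metis
      qed
      then show ?thesis
      proof cases
        case 1
        have "f y = 0" if "y < - a" for y
          unfolding f_eq
        proof (intro sum.neutral ballI)
          fix i assume "i \<in> {1..n}"
          then show "poly (P i) y * indicator {l i..<r i} y = 0"
            using la[of i] that by (auto simp: indicator_def)
        qed
        then have "\<forall>\<^sub>F y in at_left x. f y = f x"
          using fa 1 by (auto simp: eventually_at_filter)
        then show ?thesis by (rule tendsto_eventually)
      qed (use lim in auto)
    qed
    ultimately show ?thesis
      unfolding isCont_def by (intro filterlim_split_at)
  qed
  then have cont: "continuous_on UNIV f"
    by (simp add: continuous_at_imp_continuous_on)
  have "bounded_cpt_supp f"
    unfolding f_eq by (intro bounded_cpt_supp_sum bounded_cpt_supp_mult ind continuous_intros)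
  moreover have "finite S" by (simp add: S_def)
  ultimately have "pw_C1 f g"
    unfolding pw_C1_def using cont g deriv \<open>\<And>x. x \<notin> S \<Longrightarrow> isCont g x\<close> by blast
  then show thesis by (rule that)
qed


section \<open>Reflections and half masses in terms of half-line integrals\<close>

lemma left_reflection_real:
  "left_reflection (\<lambda>x. complex_of_real (f x))
    = (\<lambda>x. complex_of_real (reflect (barycenter (\<lambda>x. complex_of_real (f x))) (- 1) f x))"
  by (rule ext) (simp add: left_reflection_def reflect_def algebra_simps)

lemma right_reflection_real:
  "right_reflection (\<lambda>x. complex_of_real (f x))
    = (\<lambda>x. complex_of_real (reflect (barycenter (\<lambda>x. complex_of_real (f x))) 1 f x))"
  by (rule ext) (simp add: right_reflection_def reflect_def algebra_simps)

lemma mass_right_real: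
  "mass_right (\<lambda>x. complex_of_real (f x))
    = half_integral (barycenter (\<lambda>x. complex_of_real (f x))) 1 (\<lambda>x. (f x)\<^sup>2)"
  unfolding mass_right_def half_integral_def set_lebesgue_integral_def
  by (subst lborel_integral_real_affine[where c=1 and t="barycenter (\<lambda>x. complex_of_real (f x))"])
     (auto simp: indicator_def)

lemma mass_left_real:
  "mass_left (\<lambda>x. complex_of_real (f x))
    = half_integral (barycenter (\<lambda>x. complex_of_real (f x))) (- 1) (\<lambda>x. (f x)\<^sup>2)"
  unfolding mass_left_def half_integral_def set_lebesgue_integral_def
  by (subst lborel_integral_real_affine[where c="-1" and t="barycenter (\<lambda>x. complex_of_real (f x))"])
     (auto simp: indicator_def)


section \<open>The uncertainty inequality\<close>

text \<open>The Cauchy-Schwarz inequality in the plane, with its case of equality.\<close>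

lemma cauchy_schwarz_half_moments:
  fixes A B C D :: real
  assumes "0 \<le> A" "0 \<le> B" "0 \<le> C" "0 \<le> D"
  shows "(sqrt (A * C) + sqrt (B * D))\<^sup>2 \<le> (A + B) * (C + D)" (is ?le)
    and "(A + B) * (C + D) = (sqrt (A * C) + sqrt (B * D))\<^sup>2 \<longleftrightarrow> A * D = B * C" (is ?eq)
proof -
  have "(A + B) * (C + D) - (sqrt (A * C) + sqrt (B * D))\<^sup>2 = (sqrt (A * D) - sqrt (B * C))\<^sup>2"
    using assms by (simp add: power2_eq_square algebra_simps real_sqrt_mult)
  then have *: "(A + B) * (C + D) = (sqrt (A * C) + sqrt (B * D))\<^sup>2 + (sqrt (A * D) - sqrt (B * C))\<^sup>2"
    by simp
  show ?le unfolding * by simp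
  show ?eq unfolding * by simp
qed

lemma ennreal_sqrt_ennreal: "0 \<le> x \<Longrightarrow> ennreal_sqrt (ennreal x) = ennreal (sqrt x)"
  by (simp add: ennreal_sqrt_def)

lemma ennreal_sqrt_mean_square:
  fixes v w x y :: real
  assumes "0 \<le> v" "0 \<le> w" "0 \<le> x" "0 \<le> y"
  shows "(ennreal v * ennreal_sqrt (ennreal x) + ennreal w * ennreal_sqrt (ennreal y))\<^sup>2
    = ennreal ((v * sqrt x + w * sqrt y)\<^sup>2)"
  using assms by (simp add: ennreal_sqrt_ennreal ennreal_mult ennreal_power[symmetric])

lemma min_le_convex_sqrt:
  fixes x y w :: real
  assumes "0 \<le> x" "0 \<le> y" "0 \<le> w" "w \<le> 1"
  shows "min x y \<le> (w * sqrt x + (1 - w) * sqrt y)\<^sup>2"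
proof -
  define m where "m = min x y"
  have m: "0 \<le> m" "m \<le> x" "m \<le> y" using assms by (auto simp: m_def)
  have "sqrt m = w * sqrt m + (1 - w) * sqrt m" by (simp add: algebra_simps)
  also have "\<dots> \<le> w * sqrt x + (1 - w) * sqrt y"
    using m assms by (intro add_mono mult_left_mono) auto
  finally have "(sqrt m)\<^sup>2 \<le> (w * sqrt x + (1 - w) * sqrt y)\<^sup>2"
    using m by (intro power_mono) auto
  then show ?thesis using m by (simp add: m_def)
qed

theorem theorem2p1:
  fixes a :: real and f :: "real \<Rightarrow> real"
  assumes "a > 0"
    and "f \<in> F_0_plus a"
    and "\<exists>x. f x \<noteq> 0"
    and "absolutely_continuous_fun_on {-a..a} f"
    and "square_integrable_on {-a<..<a} (deriv f)"
  shows "let F = (\<lambda>x. complex_of_real (f x));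
             F\<^sub>s = left_reflection F;
             F\<^sub>d = right_reflection F;
             w = half_mass_weight F;
             B = (ennreal w * ennreal_sqrt (uncertainty F\<^sub>d)
                  + ennreal (1 - w) * ennreal_sqrt (uncertainty F\<^sub>s))\<^sup>2
         in uncertainty F \<ge> B
          \<and> uncertainty F \<ge> min (uncertainty F\<^sub>s) (uncertainty F\<^sub>d)
          \<and> (uncertainty F = B \<longleftrightarrow>
               ennreal (spatial_variance F\<^sub>d) * freq_variance F\<^sub>s
               = ennreal (spatial_variance F\<^sub>s) * freq_variance F\<^sub>d)"
proof -
  obtain g where fg: "pw_C1 f g"
    using F_0_plus_pw_C1[OF assms(2)] .
  obtain x0 where x0: "f x0 \<noteq> 0"
    using assms(3) by blast
  define F where "F = (\<lambda>x. complex_of_real (f x))"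
  define c where "c = barycenter F"
  define w where "w = half_mass_weight F"
  have f: "continuous_on UNIV f" "bounded_cpt_supp f" and g: "bounded_cpt_supp g"
    using fg by (auto simp: pw_C1_def)
  let ?f2 = "\<lambda>x. (f x)\<^sup>2" and ?m2 = "\<lambda>x. (x - c)\<^sup>2 * (f x)\<^sup>2" and ?g2 = "\<lambda>x. (g x)\<^sup>2"
  have u: "bounded_cpt_supp ?f2" "bounded_cpt_supp ?g2"
    using f g by (auto intro: bounded_cpt_supp_square)
  have m: "bounded_cpt_supp ?m2"
    by (intro bounded_cpt_supp_mult u continuous_intros)
  \<comment> \<open>Masses, second moments about \<open>c\<close> and Dirichlet integrals to the right and to the left of \<open>c\<close>.\<close>
  define N1 N2 where "N1 = half_integral c 1 ?f2" and "N2 = half_integral c (- 1) ?f2"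
  define A B where "A = half_integral c 1 ?m2" and "B = half_integral c (- 1) ?m2"
  define C D where "C = half_integral c 1 ?g2" and "D = half_integral c (- 1) ?g2"
  have N: "0 < N1" "0 < N2"
    unfolding N1_def N2_def by (rule half_mass_pos[OF f x0]; simp add: c_def F_def)+
  have nonneg: "0 \<le> A" "0 \<le> B" "0 \<le> C" "0 \<le> D"
    unfolding A_def B_def C_def D_def half_integral_def set_lebesgue_integral_def by simp_all
  note split = integral_eq_half_integrals[OF bounded_cpt_supp_integrable, of _ c]
  have UF: "uncertainty F = ennreal ((A + B) * (C + D) / (N1 + N2)\<^sup>2)"
  proof -
    have "spatial_variance F = (A + B) / (N1 + N2)"
      unfolding F_def spatial_variance_real
      unfolding F_def[symmetric] c_def[symmetric] split[OF u(1)] split[OF m]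
        N1_def N2_def A_def B_def by (rule refl)
    moreover have "freq_variance F = ennreal ((C + D) / (N1 + N2))"
      unfolding F_def freq_variance_pw_C1[OF fg] split[OF u(1)] split[OF u(2)]
        N1_def N2_def C_def D_def by (rule refl)
    ultimately show ?thesis
      using nonneg N
      by (simp only: uncertainty_def, subst ennreal_mult[symmetric]) (auto simp: power2_eq_square)
  qed
  have d: "spatial_variance (right_reflection F) = A / N1" "freq_variance (right_reflection F) = ennreal (C / N1)"
    using reflect_variances[OF fg _ N(1)[unfolded N1_def]]
    unfolding F_def right_reflection_real
    by (simp_all flip: F_def c_def N1_def A_def C_def)
  have s: "spatial_variance (left_reflection F) = B / N2" "freq_variance (left_reflection F) = ennreal (D / N2)"
    using reflect_variances[OF fg _ N(2)[unfolded N2_def]]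
    unfolding F_def left_reflection_real
    by (simp_all flip: F_def c_def N2_def B_def D_def)
  have Ud: "uncertainty (right_reflection F) = ennreal (A * C / N1\<^sup>2)"
    and Us: "uncertainty (left_reflection F) = ennreal (B * D / N2\<^sup>2)"
    unfolding uncertainty_def d s using nonneg N
    by (subst ennreal_mult[symmetric]; simp add: power2_eq_square)+
  have w: "w = N1 / (N1 + N2)"
    unfolding w_def half_mass_weight_def F_def mass_right_real mass_left_real
    by (simp flip: F_def c_def N1_def N2_def)
  have w1: "0 \<le> w" "0 \<le> 1 - w" "1 - w = N2 / (N1 + N2)"
    using N by (simp_all add: w field_simps)
  \<comment> \<open>The weights cancel the normalisations of the reflected functions.\<close>
  have mean: "w * sqrt (A * C / N1\<^sup>2) + (1 - w) * sqrt (B * D / N2\<^sup>2)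
      = (sqrt (A * C) + sqrt (B * D)) / (N1 + N2)"
    unfolding w1(3) using N by (simp add: w real_sqrt_divide add_divide_distrib)
  have RHS: "(ennreal w * ennreal_sqrt (uncertainty (right_reflection F))
        + ennreal (1 - w) * ennreal_sqrt (uncertainty (left_reflection F)))\<^sup>2
      = ennreal ((w * sqrt (A * C / N1\<^sup>2) + (1 - w) * sqrt (B * D / N2\<^sup>2))\<^sup>2)"
    unfolding Ud Us using nonneg w1(1,2)
    by (intro ennreal_sqrt_mean_square) auto
  have RHS': "(w * sqrt (A * C / N1\<^sup>2) + (1 - w) * sqrt (B * D / N2\<^sup>2))\<^sup>2
      = (sqrt (A * C) + sqrt (B * D))\<^sup>2 / (N1 + N2)\<^sup>2"
    by (simp only: mean power_divide)
  note cs = cauchy_schwarz_half_moments[OF nonneg]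
  have le: "(w * sqrt (A * C / N1\<^sup>2) + (1 - w) * sqrt (B * D / N2\<^sup>2))\<^sup>2 \<le> (A + B) * (C + D) / (N1 + N2)\<^sup>2"
    unfolding RHS' using cs(1) by (intro divide_right_mono) auto
  have "min (A * C / N1\<^sup>2) (B * D / N2\<^sup>2) \<le> (A + B) * (C + D) / (N1 + N2)\<^sup>2"
    by (rule order_trans[OF min_le_convex_sqrt le]) (use nonneg w1(1,2) in auto)
  then have min: "min (uncertainty (left_reflection F)) (uncertainty (right_reflection F)) \<le> uncertainty F"
    unfolding UF Ud Us by (auto simp: min_le_iff_disj intro: ennreal_leI)
  have "(A + B) * (C + D) / (N1 + N2)\<^sup>2 = (w * sqrt (A * C / N1\<^sup>2) + (1 - w) * sqrt (B * D / N2\<^sup>2))\<^sup>2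
      \<longleftrightarrow> A * D = B * C"
    unfolding RHS' cs(2)[symmetric] using N by simp
  also have "\<dots> \<longleftrightarrow> A / N1 * (D / N2) = B / N2 * (C / N1)"
    using N by (auto simp: field_simps)
  finally have "uncertainty F = ennreal ((w * sqrt (A * C / N1\<^sup>2) + (1 - w) * sqrt (B * D / N2\<^sup>2))\<^sup>2)
    \<longleftrightarrow> ennreal (A / N1) * ennreal (D / N2) = ennreal (B / N2) * ennreal (C / N1)"
    unfolding UF using nonneg N
    by (subst (1 2) ennreal_mult[symmetric]; simp)
  then show ?thesis
    unfolding Let_def F_def[symmetric] w_def[symmetric] RHS d s
    using ennreal_leI[OF le] min unfolding UF by blast
qed

end
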